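(* Assume that $k(\alpha)>0$ for all $\alpha\in R$. Then, with $z$ ranging over $\mathbb{R}^d$, $$\lim_{\|z\|\to+\infty}\{\omega_k(x)K(-ix,z)\}=0\quad\text{for all }x\in\mathbb{R}^d,$$ and $$\lim_{\|z\|\to+\infty}K(-ix,z)=0\quad\text{for all }x\in\mathbb{R}^d_{reg}.$$
   Context: $\langle\cdot,\cdot\rangle$ is the Euclidean scalar product on $\mathbb{R}^d$ ($d\ge1$) and $\|\cdot\|$ its norm. For $\alpha\in\mathbb{R}^d\setminus\{0\}$, $\sigma_\alpha(x)=x-2\frac{\langle\alpha,x\rangle}{\|\alpha\|^2}\alpha$ is the reflection in the hyperplane $H_\alpha=\alpha^{\perp}$. $R\subset\mathbb{R}^d\setminus\{0\}$ is a root system: a finite set with $R\cap\mathbb{R}\alpha=\{\pm\alpha\}$ and $\sigma_\alpha R=R$ for all $\alpha\in R$, normalized by $\|\alpha\|^2=2$. $W$ is the finite group generated by the $\sigma_\alpha$, $\alpha\in R$; $\mathbb{R}^d_{reg}=\mathbb{R}^d\setminus\bigcup_{\alpha\in R}H_\alpha$; $R_+=\{\alpha\in R:\langle\alpha,\beta\rangle>0\}$ for a fixed $\beta\in\mathbb{R}^d_{reg}$. $k:R\to[0,\infty)$ is $W$-invariant, $\omega_k(x)=\prod_{\alpha\in R_+}|\langle\alpha,x\rangle|^{2k(\alpha)}$. The Dunkl operators are $T_jf(x)=\frac{\partial f}{\partial x_j}(x)+\sum_{\alpha\in R_+}k(\alpha)\alpha_j\frac{f(x)-f(\sigma_\alpha(x))}{\langle\alpha,x\rangle}$,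 $j=1,\dots,d$. For $y\in\mathbb{R}^d$ the Dunkl kernel $x\mapsto K(x,y)$ is the unique analytic solution $u$ on $\mathbb{R}^d$ of $T_ju=y_ju$ ($j=1,\dots,d$), $u(0)=1$; $K$ has a unique holomorphic extension to $\mathbb{C}^d\times\mathbb{C}^d$.
   Formalization: The root system R is assumed to span ℝ^d; otherwise the claim fails for every such R, since for z orthogonal to all roots K(-ix,tz)=e^{-it⟨x,z⟩} has modulus 1 for all real t. *)

theory Defs
  imports "HOL-Analysis.Analysis"
begin

definition refl_root :: "real ^ 'd \<Rightarrow> real ^ 'd \<Rightarrow> real ^ 'd"
  where "refl_root \<alpha> x = x - (2 * (\<alpha> \<bullet> x) / (norm \<alpha>)\<^sup>2) *\<^sub>R \<alpha>"

definition root_hyperplane :: "real ^ 'd \<Rightarrow> (real ^ 'd) set"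
  where "root_hyperplane \<alpha> = {x. \<alpha> \<bullet> x = 0}"

definition normalized_root_system :: "(real ^ 'd) set \<Rightarrow> bool"
  where "normalized_root_system R \<longleftrightarrow>
    finite R \<and> 0 \<notin> R \<and>
    (\<forall>\<alpha>\<in>R. R \<inter> range (\<lambda>c. c *\<^sub>R \<alpha>) = {\<alpha>, - \<alpha>}) \<and>
    (\<forall>\<alpha>\<in>R. refl_root \<alpha> ` R = R) \<and>
    (\<forall>\<alpha>\<in>R. (norm \<alpha>)\<^sup>2 = 2)"

text \<open>Reflections are involutions, so closure under composition with them already yields a group.\<close>

inductive_set reflection_group :: "(real ^ 'd) set \<Rightarrow> (real ^ 'd \<Rightarrow> real ^ 'd) set"
  for R :: "(real ^ 'd) set"
  where
    "id \<in> reflection_group R"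
  | "\<alpha> \<in> R \<Longrightarrow> w \<in> reflection_group R \<Longrightarrow> refl_root \<alpha> \<circ> w \<in> reflection_group R"

definition regular_points :: "(real ^ 'd) set \<Rightarrow> (real ^ 'd) set"
  where "regular_points R = UNIV - (\<Union>\<alpha>\<in>R. root_hyperplane \<alpha>)"

definition positive_roots :: "(real ^ 'd) set \<Rightarrow> real ^ 'd \<Rightarrow> (real ^ 'd) set"
  where "positive_roots R \<beta> = {\<alpha> \<in> R. \<alpha> \<bullet> \<beta> > 0}"

definition multiplicity_function :: "(real ^ 'd) set \<Rightarrow> (real ^ 'd \<Rightarrow> real) \<Rightarrow> bool"
  where "multiplicity_function R k \<longleftrightarrow>
    (\<forall>\<alpha>\<in>R. k \<alpha> \<ge> 0) \<and> (\<forall>w\<in>reflection_group R. \<forall>\<alpha>\<in>R. k (w \<alpha>) = k \<alpha>)"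

text \<open>The case distinction is needed because \<open>0 powr 0 = 0\<close> in the library, whereas a root of
  multiplicity zero contributes the constant factor 1.\<close>

definition dunkl_weight ::
    "(real ^ 'd) set \<Rightarrow> real ^ 'd \<Rightarrow> (real ^ 'd \<Rightarrow> real) \<Rightarrow> real ^ 'd \<Rightarrow> real"
  where "dunkl_weight R \<beta> k x =
    (\<Prod>\<alpha>\<in>positive_roots R \<beta>. if k \<alpha> = 0 then 1 else \<bar>\<alpha> \<bullet> x\<bar> powr (2 * k \<alpha>))"

definition partial_deriv :: "'d \<Rightarrow> (real ^ 'd \<Rightarrow> complex) \<Rightarrow> real ^ 'd \<Rightarrow> complex"
  where "partial_deriv j f x = vector_derivative (\<lambda>t. f (x + t *\<^sub>R axis j 1)) (at 0)"

text \<open>The quotient \<open>(f x - f (\<sigma>\<^sub>\<alpha> x)) / \<langle>\<alpha>, x\<rangle>\<close> is a smooth function of \<open>x\<close> on the whole space when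
  \<open>f\<close> is smooth. On the hyperplane orthogonal to \<open>\<alpha>\<close> its value is the limit from the complement;
  the library convention \<open>0 / 0 = 0\<close> would give a wrong value there.\<close>

definition refl_quotient :: "real ^ 'd \<Rightarrow> (real ^ 'd \<Rightarrow> complex) \<Rightarrow> real ^ 'd \<Rightarrow> complex"
  where "refl_quotient \<alpha> f x =
    (if x \<in> root_hyperplane \<alpha>
     then Lim (at x within - root_hyperplane \<alpha>)
            (\<lambda>z. (f z - f (refl_root \<alpha> z)) / of_real (\<alpha> \<bullet> z))
     else (f x - f (refl_root \<alpha> x)) / of_real (\<alpha> \<bullet> x))"

definition dunkl_operator ::
    "(real ^ 'd) set \<Rightarrow> real ^ 'd \<Rightarrow> (real ^ 'd \<Rightarrow> real) \<Rightarrow> 'd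
      \<Rightarrow> (real ^ 'd \<Rightarrow> complex) \<Rightarrow> real ^ 'd \<Rightarrow> complex"
  where "dunkl_operator R \<beta> k j f x =
    partial_deriv j f x +
    (\<Sum>\<alpha>\<in>positive_roots R \<beta>. of_real (k \<alpha> * \<alpha> $ j) * refl_quotient \<alpha> f x)"

text \<open>Local expandability into a power series; multi-indices are functions \<open>'d \<Rightarrow> nat\<close>.\<close>

definition real_analytic :: "(real ^ 'd \<Rightarrow> complex) \<Rightarrow> bool"
  where "real_analytic f \<longleftrightarrow>
    (\<forall>p. \<exists>r>0. \<exists>a :: ('d \<Rightarrow> nat) \<Rightarrow> complex. \<forall>x\<in>ball p r.
       ((\<lambda>m. a m * of_real (\<Prod>i\<in>UNIV. (x $ i - p $ i) ^ m i)) has_sum f x) UNIV)"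

text \<open>Holomorphy of a function on \<open>\<complex>\<^sup>d \<times> \<complex>\<^sup>d\<close>: a complex-linear total derivative exists at
  every point.\<close>

definition holomorphic_pair :: "(complex ^ 'd \<Rightarrow> complex ^ 'd \<Rightarrow> complex) \<Rightarrow> bool"
  where "holomorphic_pair F \<longleftrightarrow>
    (\<forall>p. \<exists>D. ((\<lambda>(x, y). F x y) has_derivative D) (at p) \<and>
       (\<forall>c v w. D (c *s v, c *s w) = c * D (v, w)))"

definition cvec :: "real ^ 'd \<Rightarrow> complex ^ 'd"
  where "cvec x = (\<chi> i. complex_of_real (x $ i))"

definition dunkl_eigenfunction ::
    "(real ^ 'd) set \<Rightarrow> real ^ 'd \<Rightarrow> (real ^ 'd \<Rightarrow> real) \<Rightarrow> real ^ 'd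
      \<Rightarrow> (real ^ 'd \<Rightarrow> complex) \<Rightarrow> bool"
  where "dunkl_eigenfunction R \<beta> k y u \<longleftrightarrow>
    real_analytic u \<and>
    (\<forall>j x. dunkl_operator R \<beta> k j u x = of_real (y $ j) * u x) \<and>
    u 0 = 1"

text \<open>For a nonnegative multiplicity function there is exactly one such \<open>K\<close>: the real eigenfunction
  for each real \<open>y\<close> is unique, and a holomorphic function on \<open>\<complex>\<^sup>d \<times> \<complex>\<^sup>d\<close> is determined by its
  values at real arguments.\<close>

definition is_dunkl_kernel ::
    "(real ^ 'd) set \<Rightarrow> real ^ 'd \<Rightarrow> (real ^ 'd \<Rightarrow> real)
      \<Rightarrow> (complex ^ 'd \<Rightarrow> complex ^ 'd \<Rightarrow> complex) \<Rightarrow> bool"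
  where "is_dunkl_kernel R \<beta> k K \<longleftrightarrow>
    holomorphic_pair K \<and>
    (\<forall>y. dunkl_eigenfunction R \<beta> k y (\<lambda>x. K (cvec x) (cvec y)))"

end

theory Submission
  imports Defs "HOL-Complex_Analysis.Conformal_Mappings"
begin

text \<open>
  Fix a regular point \<open>x\<close> and a real vector \<open>z\<close>, and put \<open>F\<^sub>p(t) = K(-itp, z)\<close> for \<open>p\<close> in the finite
  orbit \<open>S\<close> of \<open>x\<close> under the reflection group. Contracting the eigenvalue equations
  \<open>T\<^sub>ju = z\<^sub>ju\<close> with \<open>p\<close> at the point \<open>tp\<close> removes the denominators \<open>\<langle>\<alpha>, tp\<rangle>\<close> of the Dunkl operators
  up to the factor \<open>1/t\<close>. By the identity theorem the resulting equation passes from real \<open>t\<close> to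
  imaginary \<open>t\<close> (\<open>ray_equation\<close>, \<open>ray_ode\<close>), where it reads
  \<open>F\<^sub>p' = -i\<langle>p, z\<rangle> F\<^sub>p - (1/t) \<Sum>\<^sub>\<alpha> k(\<alpha>) (F\<^sub>p - F\<^sub>q)\<close> with \<open>q = \<sigma>\<^sub>\<alpha>p\<close>, and \<open>F\<^sub>p(0) = 1\<close>.

  The first term only rotates \<open>F\<^sub>p\<close>. The second one dissipates: the energy \<open>E = \<Sum>\<^sub>p |F\<^sub>p|\<^sup>2\<close> satisfies
  \<open>E' = -(1/t) \<Sum>\<^sub>\<alpha> k(\<alpha>) \<Sum>\<^sub>p |F\<^sub>p - F\<^sub>q|\<^sup>2 \<le> 0\<close>, so that \<open>E\<close> is bounded by the number of points of
  the orbit. The decay comes from a single root \<open>\<alpha>\<close>, which may depend on \<open>z\<close>. Since the roots span the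
  space, some \<open>|\<langle>\<alpha>, z\<rangle>|\<close> is at least a fixed multiple of \<open>\<parallel>z\<parallel>\<close>
  (\<open>exists_large_root_pairing\<close>). The correlations \<open>F\<^sub>p\<close> times the conjugate of \<open>F\<^sub>q\<close> then rotate with the
  frequency \<open>\<langle>p, z\<rangle> - \<langle>q, z\<rangle> = \<langle>\<alpha>, p\<rangle>\<langle>\<alpha>, z\<rangle>\<close>, which is large because \<open>p\<close> is regular. So the mixed
  terms in \<open>|F\<^sub>p - F\<^sub>q|\<^sup>2\<close> average out, and effectively \<open>E' \<le> -(2k(\<alpha>)/t) E\<close> for \<open>t\<close> between
  \<open>1/\<parallel>z\<parallel>\<close> and \<open>1\<close>. As \<open>\<integral> dt/t = ln \<parallel>z\<parallel>\<close> over this range, \<open>E(1)\<close> is bounded by a constant divided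
  by \<open>1 + 2k(\<alpha>) ln \<parallel>z\<parallel>\<close> (\<open>energy_decay\<close>, \<open>dunkl_kernel_log_bound\<close>). The constants are uniform in
  the direction of \<open>z\<close>, including directions inside or close to the reflecting hyperplanes.

  For a point \<open>x\<close> on a reflecting hyperplane the weight vanishes, because all multiplicities are
  positive; so the limit with the weight follows from the limit at regular points.
\<close>

section \<open>Energy decay for rotations coupled by involutions\<close>

text \<open>
  The system satisfied by the Dunkl kernel along the imaginary ray through an orbit, reduced to what
  the energy argument uses: the unknowns are indexed by a finite set \<open>S\<close> on which each index
  \<open>b \<in> P\<close> acts by an involution.
\<close>

locale reflection_ode =
  fixes S :: "'a set" and P :: "'b set" and s :: "'b \<Rightarrow> 'a \<Rightarrow> 'a"
    and k :: "'b \<Rightarrow> real" and freq :: "'a \<Rightarrow> real" and F :: "'a \<Rightarrow> real \<Rightarrow> complex"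
  assumes finite_S: "finite S"
    and finite_P: "finite P"
    and s_mem: "\<And>b p. b \<in> P \<Longrightarrow> p \<in> S \<Longrightarrow> s b p \<in> S"
    and s_invol: "\<And>b p. b \<in> P \<Longrightarrow> p \<in> S \<Longrightarrow> s b (s b p) = p"
    and k_nonneg: "\<And>b. b \<in> P \<Longrightarrow> 0 \<le> k b"
    and ode: "\<And>p t. p \<in> S \<Longrightarrow> 0 < t \<Longrightarrow>
      (F p has_vector_derivative
        - (\<i> * of_real (freq p) * F p t)
        - (\<Sum>b\<in>P. of_real (k b) * (F p t - F (s b p) t)) / of_real t) (at t)"
    and F_cont: "\<And>p. p \<in> S \<Longrightarrow> isCont (F p) 0"
    and F_0: "\<And>p. p \<in> S \<Longrightarrow> F p 0 = 1"
begin

definition coupling :: "'a \<Rightarrow> real \<Rightarrow> complex"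
  where "coupling p t = (\<Sum>b\<in>P. of_real (k b) * (F p t - F (s b p) t))"

definition energy :: "real \<Rightarrow> real"
  where "energy t = (\<Sum>p\<in>S. (norm (F p t))\<^sup>2)"

lemma sum_reindex_reflection:
  assumes "b \<in> P"
  shows "(\<Sum>p\<in>S. h (s b p)) = (\<Sum>p\<in>S. h p)"
  by (rule sum.reindex_bij_witness[where i = "s b" and j = "s b"])
    (use assms s_mem s_invol in auto)

text \<open>
  Pairing \<open>p\<close> with \<open>s b p\<close> symmetrizes the sum: this is the positivity of the coupling operator
  \<open>id - s b\<close> as a quadratic form.
\<close>

lemma sum_inner_difference:
  assumes b: "b \<in> P"
  shows "2 * (\<Sum>p\<in>S. F p t \<bullet> (F p t - F (s b p) t)) = (\<Sum>p\<in>S. (norm (F p t - F (s b p) t))\<^sup>2)"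
proof -
  have "(\<Sum>p\<in>S. (norm (F p t - F (s b p) t))\<^sup>2)
      = (\<Sum>p\<in>S. F p t \<bullet> (F p t - F (s b p) t) + F (s b p) t \<bullet> (F (s b p) t - F p t))"
    by (intro sum.cong refl) (simp add: power2_norm_eq_inner inner_diff inner_commute)
  also have "\<dots> = (\<Sum>p\<in>S. F p t \<bullet> (F p t - F (s b p) t))
      + (\<Sum>p\<in>S. F (s b p) t \<bullet> (F (s b p) t - F (s b (s b p)) t))"
    using s_invol[OF b] by (simp add: sum.distrib)
  also have "(\<Sum>p\<in>S. F (s b p) t \<bullet> (F (s b p) t - F (s b (s b p)) t))
      = (\<Sum>p\<in>S. F p t \<bullet> (F p t - F (s b p) t))"
    by (rule sum_reindex_reflection[OF b])
  finally show ?thesis by simp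
qed

lemma energy_derivative:
  assumes t: "0 < t"
  shows "(energy has_real_derivative
    - (\<Sum>b\<in>P. k b * (\<Sum>p\<in>S. (norm (F p t - F (s b p) t))\<^sup>2)) / t) (at t)"
proof -
  have "((\<lambda>t. F p t \<bullet> F p t) has_vector_derivative - 2 * (F p t \<bullet> coupling p t) / t) (at t)"
    if p: "p \<in> S" for p
  proof -
    \<comment> \<open>the oscillating term is orthogonal to \<open>F p t\<close>, so it does not change the modulus\<close>
    have rot: "F p t \<bullet> (\<i> * of_real (freq p) * F p t) = 0"
      by (simp add: inner_complex_def)
    have "coupling p t / of_real t = (1 / t) *\<^sub>R coupling p t"
      by (simp add: scaleR_conv_of_real)
    then have "F p t \<bullet> (- (\<i> * of_real (freq p) * F p t) - coupling p t / of_real t)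
        = - (F p t \<bullet> coupling p t) / t"
      using rot by (simp only: inner_diff_right inner_minus_right inner_scaleR_right) simp
    then show ?thesis
      using bounded_bilinear.has_vector_derivative[OF bounded_bilinear_inner ode[OF p t] ode[OF p t]]
      unfolding coupling_def by (simp add: inner_commute)
  qed
  then have "((\<lambda>t. \<Sum>p\<in>S. F p t \<bullet> F p t) has_vector_derivative
      (\<Sum>p\<in>S. - 2 * (F p t \<bullet> coupling p t) / t)) (at t)"
    by (intro has_vector_derivative_sum)
  moreover have "(\<Sum>p\<in>S. - 2 * (F p t \<bullet> coupling p t) / t)
      = - (\<Sum>b\<in>P. k b * (\<Sum>p\<in>S. (norm (F p t - F (s b p) t))\<^sup>2)) / t"
  proof -
    have "(\<Sum>p\<in>S. F p t \<bullet> coupling p t)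
        = (\<Sum>p\<in>S. \<Sum>b\<in>P. k b * (F p t \<bullet> (F p t - F (s b p) t)))"
      unfolding coupling_def inner_sum_right
      by (intro sum.cong refl) (simp add: inner_complex_def algebra_simps)
    also have "\<dots> = (\<Sum>b\<in>P. k b * (\<Sum>p\<in>S. F p t \<bullet> (F p t - F (s b p) t)))"
      by (subst sum.swap) (simp add: sum_distrib_left)
    finally have "2 * (\<Sum>p\<in>S. F p t \<bullet> coupling p t)
        = (\<Sum>b\<in>P. k b * (\<Sum>p\<in>S. (norm (F p t - F (s b p) t))\<^sup>2))"
      by (simp add: sum_distrib_left flip: sum_inner_difference) (simp add: mult.left_commute sum_distrib_left)
    then show ?thesis
      by (simp add: sum_distrib_left sum_negf flip: sum_divide_distrib)
  qed
  ultimately show ?thesis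
    unfolding energy_def has_real_derivative_iff_has_vector_derivative power2_norm_eq_inner by simp
qed

lemma energy_antimono:
  assumes "0 \<le> a" "a \<le> b"
  shows "energy b \<le> energy a"
proof (rule DERIV_nonpos_imp_decreasing_open[OF assms(2)])
  fix t assume "a < t" "t < b"
  then have t: "0 < t" using assms by simp
  have "- (\<Sum>b\<in>P. k b * (\<Sum>p\<in>S. (norm (F p t - F (s b p) t))\<^sup>2)) / t \<le> 0"
    using t by (intro divide_nonpos_pos) (auto intro!: sum_nonneg mult_nonneg_nonneg k_nonneg)
  then show "\<exists>y. (energy has_real_derivative y) (at t) \<and> y \<le> 0"
    using energy_derivative[OF t] by blast
next
  have "isCont (F p) t" if "p \<in> S" "0 \<le> t" for p t
    using that F_cont[of p] has_vector_derivative_continuous[OF ode[of p t]]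
    by (cases "t = 0") auto
  then show "continuous_on {a..b} energy"
    unfolding energy_def using assms
    by (intro continuous_intros continuous_at_imp_continuous_on) auto
qed

lemma energy_0: "energy 0 = card S"
  unfolding energy_def by (simp add: F_0)

lemma norm_F_le:
  assumes "p \<in> S" "0 \<le> t"
  shows "norm (F p t) \<le> sqrt (card S)"
proof -
  have "(norm (F p t))\<^sup>2 \<le> energy t"
    unfolding energy_def using assms finite_S by (intro member_le_sum) auto
  also have "\<dots> \<le> card S"
    using energy_antimono[of 0 t] assms energy_0 by simp
  finally show ?thesis by (rule real_le_rsqrt)
qed

lemma norm_coupling_le:
  assumes p: "p \<in> S" and t: "0 \<le> t"
  shows "norm (coupling p t) \<le> 2 * sum k P * sqrt (card S)"
proof -
  have "norm (coupling p t) \<le> (\<Sum>b\<in>P. k b * (2 * sqrt (card S)))"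
    unfolding coupling_def
  proof (rule sum_norm_le)
    fix b assume b: "b \<in> P"
    have "norm (F p t - F (s b p) t) \<le> norm (F p t) + norm (F (s b p) t)"
      by (rule norm_triangle_ineq4)
    also have "\<dots> \<le> 2 * sqrt (card S)"
      using norm_F_le[OF p t] norm_F_le[OF s_mem[OF b p] t] by simp
    finally show "norm (of_real (k b) * (F p t - F (s b p) t)) \<le> k b * (2 * sqrt (card S))"
      using k_nonneg[OF b] by (simp add: norm_mult mult_left_mono)
  qed
  then show ?thesis by (simp add: sum_distrib_left sum_distrib_right mult.commute mult.left_commute)
qed

text \<open>
  The mixed terms in the dissipation are the real parts of \<open>correlation\<close>. Its derivative consists of
  a fast rotation, with the difference of the two frequencies, and of \<open>correlation_drift\<close> divided by
  \<open>t\<close>.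
\<close>

definition correlation :: "'b \<Rightarrow> 'a \<Rightarrow> real \<Rightarrow> complex"
  where "correlation a p t = F p t * cnj (F (s a p) t)"

definition correlation_drift :: "'b \<Rightarrow> 'a \<Rightarrow> real \<Rightarrow> complex"
  where "correlation_drift a p t =
    - (F p t * cnj (coupling (s a p) t) + coupling p t * cnj (F (s a p) t))"

lemma norm_correlation_le:
  assumes "a \<in> P" "p \<in> S" "0 \<le> t"
  shows "norm (correlation a p t) \<le> card S"
proof -
  have "norm (correlation a p t) \<le> sqrt (card S) * sqrt (card S)"
    unfolding correlation_def norm_mult complex_mod_cnj
    using assms s_mem by (intro mult_mono norm_F_le) auto
  then show ?thesis by simp
qed

lemma norm_correlation_drift_le:
  assumes "a \<in> P" "p \<in> S" "0 \<le> t"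
  shows "norm (correlation_drift a p t) \<le> 4 * sum k P * card S"
proof -
  have "norm (correlation_drift a p t)
      \<le> norm (F p t) * norm (coupling (s a p) t) + norm (coupling p t) * norm (F (s a p) t)"
    unfolding correlation_drift_def norm_minus_cancel
    by (rule order_trans[OF norm_triangle_ineq]) (simp add: norm_mult)
  also have "\<dots> \<le> sqrt (card S) * (2 * sum k P * sqrt (card S))
      + (2 * sum k P * sqrt (card S)) * sqrt (card S)"
    using assms s_mem k_nonneg
    by (intro add_mono mult_mono norm_F_le norm_coupling_le) (auto intro!: sum_nonneg mult_nonneg_nonneg)
  also have "\<dots> = 4 * sum k P * (sqrt (card S) * sqrt (card S))"
    by (simp add: algebra_simps)
  finally show ?thesis by simp
qed

lemma correlation_derivative:
  assumes a: "a \<in> P" and p: "p \<in> S" and t: "0 < t"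
  shows "(correlation a p has_vector_derivative
    - (\<i> * of_real (freq p - freq (s a p)) * correlation a p t)
    + correlation_drift a p t / of_real t) (at t)"
proof -
  note dF = ode[OF p t, folded coupling_def]
  note dG = has_vector_derivative_cnj[OF ode[OF s_mem[OF a p] t, folded coupling_def]]
  show ?thesis
    unfolding correlation_def
    by (rule has_vector_derivative_eq_rhs[OF has_vector_derivative_mult[OF dF dG]])
      (use t in \<open>simp add: correlation_drift_def coupling_def field_simps\<close>)
qed

lemma Im_correlation_derivative:
  assumes a: "a \<in> P" and p: "p \<in> S" and t: "0 < t"
  shows "((\<lambda>t. Im (correlation a p t)) has_real_derivative
    Im (correlation_drift a p t) / t - (freq p - freq (s a p)) * Re (correlation a p t)) (at t)"
  using bounded_linear.has_vector_derivative[OF bounded_linear_Im correlation_derivative[OF assms]]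
  by (simp add: has_real_derivative_iff_has_vector_derivative Im_divide_of_real)

text \<open>
  Only the dissipation along one index \<open>a\<close> is kept. If the correlations were absent, this would give
  decay of the energy at the relative rate \<open>2 * k a / t\<close>.
\<close>

lemma energy_dissipation:
  assumes a: "a \<in> P" and t: "0 < t"
  shows "- (\<Sum>b\<in>P. k b * (\<Sum>p\<in>S. (norm (F p t - F (s b p) t))\<^sup>2)) / t
    \<le> - (2 * k a / t) * (energy t - (\<Sum>p\<in>S. Re (correlation a p t)))"
proof -
  have "(\<Sum>p\<in>S. (norm (F p t - F (s a p) t))\<^sup>2)
      = (\<Sum>p\<in>S. (norm (F p t))\<^sup>2 + (norm (F (s a p) t))\<^sup>2 - 2 * Re (correlation a p t))"
    by (intro sum.cong refl)
      (simp only: correlation_def cmod_power2, simp add: power2_eq_square algebra_simps)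
  also have "\<dots> = energy t + (\<Sum>p\<in>S. (norm (F (s a p) t))\<^sup>2) - 2 * (\<Sum>p\<in>S. Re (correlation a p t))"
    by (simp add: energy_def sum.distrib sum_subtractf sum_distrib_left)
  also have "(\<Sum>p\<in>S. (norm (F (s a p) t))\<^sup>2) = energy t"
    unfolding energy_def by (rule sum_reindex_reflection[OF a])
  finally have eq: "(\<Sum>p\<in>S. (norm (F p t - F (s a p) t))\<^sup>2)
      = 2 * (energy t - (\<Sum>p\<in>S. Re (correlation a p t)))" by simp
  have "k a * (\<Sum>p\<in>S. (norm (F p t - F (s a p) t))\<^sup>2)
      \<le> (\<Sum>b\<in>P. k b * (\<Sum>p\<in>S. (norm (F p t - F (s b p) t))\<^sup>2))"
    using finite_P a by (intro member_le_sum) (auto intro!: mult_nonneg_nonneg sum_nonneg k_nonneg)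
  then have "2 * k a * (energy t - (\<Sum>p\<in>S. Re (correlation a p t))) / t
      \<le> (\<Sum>b\<in>P. k b * (\<Sum>p\<in>S. (norm (F p t - F (s b p) t))\<^sup>2)) / t"
    using t unfolding eq by (intro divide_right_mono) (auto simp: algebra_simps)
  then show ?thesis by simp
qed

text \<open>
  The rotation equation expresses each \<open>Re (correlation a p t)\<close>, up to a term of order \<open>1 / (L t)\<close>,
  as the derivative of \<open>- Im (correlation a p t)\<close> divided by the frequency gap, a quantity of order
  \<open>1 / L\<close>. Hence adding to the energy the correction \<open>2 * k a * Q t / t\<close>, where \<open>Q\<close> sums
  these quotients, cancels the correlations in the derivative. What remains is
  \<open>- 2 * k a * energy t / t\<close> and an error of order \<open>1 / (L t\<^sup>2)\<close>, whose integral over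
  \<open>[1 / L, 1]\<close> is bounded; since the energy decreases, the main term contributes at least
  \<open>2 * k a * energy 1 * ln L\<close>.
\<close>

lemma energy_decay:
  assumes a: "a \<in> P" and L: "1 \<le> L"
    and gap: "\<And>p. p \<in> S \<Longrightarrow> L \<le> \<bar>freq p - freq (s a p)\<bar>"
  shows "energy 1 * (1 + 2 * k a * ln L)
    \<le> card S + 4 * k a * ((4 * sum k P + 1) * (card S)\<^sup>2)"
proof -
  define N where "N = real (card S)"
  define B where "B = (4 * sum k P + 1) * N\<^sup>2"
  define \<Delta> where "\<Delta> p = freq p - freq (s a p)" for p
  define Q where "Q t = (\<Sum>p\<in>S. Im (correlation a p t) / \<Delta> p)" for t
  define D where "D t = (\<Sum>p\<in>S. Im (correlation_drift a p t) / \<Delta> p)" for t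
  \<comment> \<open>the corrected energy, plus an antiderivative of the guaranteed decay rate and minus
    one of the error bound, so that \<open>J\<close> is nonincreasing\<close>
  define J where "J t = energy t + 2 * k a * (Q t / t) + 2 * k a * energy 1 * ln t
    + 2 * k a * B / L / t" for t
  have N0: "0 \<le> N" by (simp add: N_def)
  have NB: "N * N \<le> B"
  proof -
    have "0 \<le> sum k P" by (intro sum_nonneg k_nonneg)
    then have "1 * (N * N) \<le> (4 * sum k P + 1) * (N * N)"
      by (intro mult_right_mono) (use N0 in auto)
    then show ?thesis by (simp add: B_def power2_eq_square)
  qed
  have ka: "0 \<le> k a" by (rule k_nonneg[OF a])
  have \<Delta>: "L \<le> \<bar>\<Delta> p\<bar>" "\<Delta> p \<noteq> 0" if "p \<in> S" for p
    using gap[OF that] L by (auto simp: \<Delta>_def)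
  have div_bound: "\<bar>\<Sum>p\<in>S. h p / \<Delta> p\<bar> \<le> N * M / L"
    if "\<And>p. p \<in> S \<Longrightarrow> \<bar>h p\<bar> \<le> M" for h :: "'a \<Rightarrow> real" and M
  proof -
    have "\<bar>\<Sum>p\<in>S. h p / \<Delta> p\<bar> \<le> (\<Sum>p\<in>S. \<bar>h p / \<Delta> p\<bar>)" by (rule sum_abs)
    also have "\<dots> \<le> (\<Sum>p\<in>S. M / L)"
      unfolding abs_divide
      using that \<Delta> L by (intro sum_mono frac_le) (auto intro: order_trans[OF abs_ge_zero])
    finally show ?thesis by (simp add: N_def)
  qed
  have Q_bound: "\<bar>Q t\<bar> \<le> N * N / L" if "0 \<le> t" for t
    unfolding Q_def using norm_correlation_le[OF a] that
    by (intro div_bound) (auto simp: N_def intro: order_trans[OF abs_Im_le_cmod])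
  have D_bound: "\<bar>D t\<bar> \<le> N * (4 * sum k P * N) / L" if "0 \<le> t" for t
    unfolding D_def using norm_correlation_drift_le[OF a] that
    by (intro div_bound) (auto simp: N_def intro: order_trans[OF abs_Im_le_cmod])
  have DQ_bound: "D t - Q t \<le> B / L" if "0 \<le> t" for t
  proof -
    have "D t - Q t \<le> N * (4 * sum k P * N) / L + N * N / L"
      using D_bound[OF that] Q_bound[OF that] by linarith
    then show ?thesis
      unfolding B_def by (simp add: algebra_simps add_divide_distrib power2_eq_square)
  qed
  have dQ: "(Q has_real_derivative - (\<Sum>p\<in>S. Re (correlation a p t)) + D t / t) (at t)"
    if t: "0 < t" for t
  proof -
    have "(Q has_real_derivative (\<Sum>p\<in>S.
        (Im (correlation_drift a p t) / t - \<Delta> p * Re (correlation a p t)) / \<Delta> p)) (at t)"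
      unfolding Q_def \<Delta>_def
      by (intro DERIV_sum DERIV_cdivide Im_correlation_derivative a t)
    also have "(\<Sum>p\<in>S. (Im (correlation_drift a p t) / t - \<Delta> p * Re (correlation a p t)) / \<Delta> p)
        = (\<Sum>p\<in>S. - Re (correlation a p t) + Im (correlation_drift a p t) / \<Delta> p / t)"
      using \<Delta>(2) t by (intro sum.cong refl) (simp add: field_simps)
    also have "\<dots> = - (\<Sum>p\<in>S. Re (correlation a p t)) + D t / t"
      by (simp add: D_def sum.distrib sum_negf sum_subtractf sum_divide_distrib)
    finally show ?thesis .
  qed
  have "J 1 \<le> J (1 / L)"
  proof (rule DERIV_nonpos_imp_nonincreasing[where f = J and a = "1 / L" and b = 1])
    show "1 / L \<le> 1" using L by simp
    fix t assume "1 / L \<le> t" "t \<le> 1"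
    moreover have "0 < 1 / L" using L by simp
    ultimately have t: "0 < t" and t1: "t \<le> 1" by linarith+
    let ?R = "\<Sum>p\<in>S. Re (correlation a p t)"
    let ?E' = "- (\<Sum>b\<in>P. k b * (\<Sum>p\<in>S. (norm (F p t - F (s b p) t))\<^sup>2)) / t"
    let ?J' = "?E' + 2 * k a * (((- ?R + D t / t) * t - Q t) / (t * t)) + 2 * k a * energy 1 / t
      - 2 * k a * B / L / (t * t)"
    have "(J has_real_derivative ?J') (at t)"
      unfolding J_def
      by (rule derivative_eq_intros energy_derivative[OF t] dQ[OF t] refl | use t in simp)+
    moreover have "?J' \<le> 0"
    proof -
      have "?J' \<le> - (2 * k a / t) * (energy t - ?R)
          + 2 * k a * (((- ?R + D t / t) * t - Q t) / (t * t)) + 2 * k a * energy 1 / t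
          - 2 * k a * B / L / (t * t)"
        using energy_dissipation[OF a t] by linarith
      \<comment> \<open>the correlations \<open>?R\<close> cancel here\<close>
      also have "\<dots> = (2 * k a / t) * (energy 1 - energy t)
          + (2 * k a / (t * t)) * (D t - Q t - B / L)"
        using t L by (simp add: field_simps)
      also have "\<dots> \<le> 0"
        using energy_antimono[of t 1] DQ_bound[of t] t t1 ka
        by (intro add_nonpos_nonpos mult_nonneg_nonpos) auto
      finally show ?thesis .
    qed
    ultimately show "\<exists>y. (J has_real_derivative y) (at t) \<and> y \<le> 0" by blast
  qed
  moreover have "J 1 \<ge> energy 1"
  proof -
    have "N * N / L \<le> B / L" using NB L by (simp add: divide_right_mono)
    then have "0 \<le> Q 1 + B / L" using Q_bound[of 1] by simp
    then have "0 \<le> 2 * k a * (Q 1 + B / L)" using ka by simp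
    then show ?thesis by (simp add: J_def algebra_simps)
  qed
  moreover have "J (1 / L) \<le> N + 4 * k a * B - 2 * k a * energy 1 * ln L"
  proof -
    have "Q (1 / L) * L \<le> B"
      using NB Q_bound[of "1 / L"] L by (simp add: field_simps abs_le_iff)
    then have "2 * k a * (Q (1 / L) * L) \<le> 2 * k a * B"
      using ka by (intro mult_left_mono) auto
    moreover have "energy (1 / L) \<le> N"
      using energy_antimono[of 0 "1 / L"] L by (simp add: energy_0 N_def)
    ultimately show ?thesis
      using L by (simp add: J_def ln_div algebra_simps)
  qed
  ultimately show ?thesis
    by (simp add: N_def B_def algebra_simps)
qed

end


section \<open>The Dunkl kernel along complex lines\<close>

lemma scale_vec_has_derivative:
  fixes v :: "complex ^ 'd"
  shows "((\<lambda>\<zeta>. \<zeta> *s v) has_derivative (\<lambda>h. h *s v)) (at \<zeta>)"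
proof -
  have "linear (\<lambda>h. h *s v)"
    by (rule linearI) (simp_all add: vec_eq_iff algebra_simps)
  then show ?thesis
    by (intro bounded_linear_imp_has_derivative) (simp add: linear_conv_bounded_linear)
qed

lemma cvec_add_scaleR: "cvec (x + t *\<^sub>R v) = cvec x + t *\<^sub>R cvec v"
  by (simp add: cvec_def vec_eq_iff) (simp add: scaleR_conv_of_real)

lemma cvec_scaleR: "cvec (t *\<^sub>R v) = of_real t *s cvec v"
  by (simp add: cvec_def vec_eq_iff)

lemma cvec_0: "cvec 0 = 0"
  by (simp add: cvec_def vec_eq_iff)

lemma cvec_eq_sum_axis:
  fixes p :: "real ^ 'd"
  shows "cvec p = (\<Sum>j\<in>UNIV. of_real (p $ j) *s cvec (axis j 1))"
proof -
  have "(of_real (p $ j) *s cvec (axis j 1) :: complex ^ 'd) $ i = (if i = j then of_real (p $ i) else 0)" for i j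
    by (simp add: cvec_def axis_def)
  then show ?thesis
    by (simp add: vec_eq_iff cvec_def)
qed

definition ray_value ::
    "(complex ^ 'd \<Rightarrow> complex ^ 'd \<Rightarrow> complex) \<Rightarrow> real ^ 'd \<Rightarrow> real ^ 'd \<Rightarrow> complex \<Rightarrow> complex"
  where "ray_value K z p \<zeta> = K (\<zeta> *s cvec p) (cvec z)"

lemma ray_value_has_field_derivative:
  assumes D: "((\<lambda>(x, y). K x y) has_derivative D) (at (\<zeta> *s cvec p, cvec z))"
    and D_scale: "\<And>c v w. D (c *s v, c *s w) = c * D (v, w)"
  shows "(ray_value K z p has_field_derivative D (cvec p, 0)) (at \<zeta>)"
proof -
  have "((\<lambda>\<zeta>. (\<zeta> *s cvec p, cvec z)) has_derivative (\<lambda>h. (h *s cvec p, 0))) (at \<zeta>)"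
    by (intro has_derivative_Pair scale_vec_has_derivative has_derivative_const)
  from has_derivative_compose[OF this D]
  have "(ray_value K z p has_derivative (\<lambda>h. D (h *s cvec p, 0))) (at \<zeta>)"
    by (simp add: ray_value_def[abs_def])
  moreover have "D (h *s cvec p, 0) = D (cvec p, 0) * h" for h
    using D_scale[of h "cvec p" 0] by simp
  ultimately show ?thesis
    by (simp add: has_field_derivative_def)
qed

lemma ray_value_holomorphic:
  assumes "holomorphic_pair K"
  shows "ray_value K z p holomorphic_on UNIV"
proof -
  have "ray_value K z p field_differentiable at \<zeta>" for \<zeta>
    using assms ray_value_has_field_derivative[of K _ \<zeta> p z]
    unfolding holomorphic_pair_def field_differentiable_def by blast
  then show ?thesis
    by (simp add: holomorphic_on_def)
qed

lemma refl_root_fixes_hyperplane: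
  assumes "x \<in> root_hyperplane \<alpha>"
  shows "refl_root \<alpha> x = x"
  using assms by (simp add: refl_root_def root_hyperplane_def)

lemma refl_root_scaleR: "refl_root \<alpha> (t *\<^sub>R x) = t *\<^sub>R refl_root \<alpha> x"
  by (simp add: refl_root_def algebra_simps)

text \<open>
  On the hyperplane both sides vanish, whatever limit the quotient takes there. Therefore the
  equation along a ray below holds for every \<open>p\<close> and also at \<open>t = 0\<close>.
\<close>

lemma inner_refl_quotient:
  "of_real (\<alpha> \<bullet> x) * refl_quotient \<alpha> u x = u x - u (refl_root \<alpha> x)"
  using refl_root_fixes_hyperplane[of x \<alpha>]
  by (auto simp: refl_quotient_def root_hyperplane_def)

text \<open>
  The eigenvalue equations at \<open>x = t p\<close>, contracted with \<open>t p\<close>: the partial derivatives combine to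
  the derivative along the ray, and the factor \<open>\<langle>\<alpha>, x\<rangle>\<close> cancels the denominator of the reflection
  quotient.
\<close>

lemma ray_equation_real:
  assumes K: "is_dunkl_kernel R \<beta> k K"
  shows "of_real t * deriv (ray_value K z p) (of_real t)
    = of_real (t * (p \<bullet> z)) * ray_value K z p (of_real t)
      - (\<Sum>\<alpha>\<in>positive_roots R \<beta>.
          of_real (k \<alpha>) * (ray_value K z p (of_real t) - ray_value K z (refl_root \<alpha> p) (of_real t)))"
proof -
  define u where "u = (\<lambda>x. K (cvec x) (cvec z))"
  define x where "x = t *\<^sub>R p"
  have u_ray: "u (t *\<^sub>R q) = ray_value K z q (of_real t)" for q
    by (simp add: u_def ray_value_def cvec_scaleR)
  obtain D where D: "((\<lambda>(x, y). K x y) has_derivative D) (at (cvec x, cvec z))"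
    and D_scale: "\<And>c v w. D (c *s v, c *s w) = c * D (v, w)"
    using K unfolding is_dunkl_kernel_def holomorphic_pair_def by blast
  have ray_deriv: "deriv (ray_value K z p) (of_real t) = D (cvec p, 0)"
    using D D_scale by (intro DERIV_imp_deriv ray_value_has_field_derivative)
      (simp_all add: x_def cvec_scaleR)
  have partial: "partial_deriv j u x = D (cvec (axis j 1), 0)" for j
  proof -
    let ?e = "cvec (axis j 1)"
    have "((\<lambda>h. (cvec x + h *\<^sub>R ?e, cvec z)) has_derivative (\<lambda>h. (h *\<^sub>R ?e, 0))) (at 0)"
      by (auto intro!: derivative_eq_intros)
    from has_derivative_compose[OF this, of "\<lambda>(x, y). K x y" D]
    have "((\<lambda>h. u (x + h *\<^sub>R axis j 1)) has_derivative (\<lambda>h. D (h *\<^sub>R ?e, 0))) (at 0)"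
      using D by (simp add: u_def cvec_add_scaleR)
    moreover have "D (h *\<^sub>R ?e, 0) = h *\<^sub>R D (?e, 0)" for h
      using linear_scale[OF has_derivative_linear[OF D], of h "(?e, 0)"] by simp
    ultimately show ?thesis
      unfolding partial_deriv_def
      by (intro vector_derivative_at) (simp add: has_vector_derivative_def)
  qed
  have "D (cvec p, 0) = (\<Sum>j\<in>UNIV. D (of_real (p $ j) *s cvec (axis j 1), 0))"
    using linear_sum[OF has_derivative_linear[OF D],
        of "\<lambda>j. (of_real (p $ j) *s cvec (axis j 1), 0)" UNIV]
    by (subst cvec_eq_sum_axis) (simp add: sum_prod)
  also have "\<dots> = (\<Sum>j\<in>UNIV. of_real (p $ j) * partial_deriv j u x)"
    using D_scale[of _ _ 0] by (simp add: partial)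
  finally have D_sum: "D (cvec p, 0) = (\<Sum>j\<in>UNIV. of_real (p $ j) * partial_deriv j u x)" .
  have eigen: "dunkl_operator R \<beta> k j u x = of_real (z $ j) * u x" for j
    using K unfolding is_dunkl_kernel_def dunkl_eigenfunction_def u_def by blast
  have "of_real (p \<bullet> z) * u x = (\<Sum>j\<in>UNIV. of_real (p $ j) * dunkl_operator R \<beta> k j u x)"
    by (simp add: eigen inner_vec_def sum_distrib_right mult.assoc)
  also have "\<dots> = D (cvec p, 0) + (\<Sum>j\<in>UNIV. \<Sum>\<alpha>\<in>positive_roots R \<beta>.
      of_real (k \<alpha>) * (of_real (\<alpha> $ j * p $ j) * refl_quotient \<alpha> u x))"
    unfolding dunkl_operator_def D_sum
    by (simp add: algebra_simps sum.distrib sum_distrib_left)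
  also have "(\<Sum>j\<in>UNIV. \<Sum>\<alpha>\<in>positive_roots R \<beta>.
      of_real (k \<alpha>) * (of_real (\<alpha> $ j * p $ j) * refl_quotient \<alpha> u x))
      = (\<Sum>\<alpha>\<in>positive_roots R \<beta>. of_real (k \<alpha>) * (of_real (\<alpha> \<bullet> p) * refl_quotient \<alpha> u x))"
    by (subst sum.swap) (simp add: inner_vec_def flip: sum_distrib_left sum_distrib_right)
  finally have "of_real t * D (cvec p, 0) = of_real (t * (p \<bullet> z)) * u x
      - (\<Sum>\<alpha>\<in>positive_roots R \<beta>. of_real (k \<alpha>) * (of_real (\<alpha> \<bullet> x) * refl_quotient \<alpha> u x))"
    by (simp add: x_def algebra_simps sum_distrib_left)
  then show ?thesis
    unfolding inner_refl_quotient ray_deriv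
    by (simp add: x_def u_ray refl_root_scaleR)
qed

lemma zero_islimpt_real_axis: "(0::complex) islimpt \<real>"
proof (unfold islimpt_approachable, intro allI impI)
  fix e :: real assume "0 < e"
  then show "\<exists>y\<in>\<real>. y \<noteq> (0::complex) \<and> dist y 0 < e"
    by (intro bexI[of _ "of_real (e / 2)"]) (auto simp: norm_divide)
qed

text \<open>
  Both sides are entire in \<open>\<zeta>\<close> and agree on the real axis.
\<close>

lemma ray_equation:
  assumes K: "is_dunkl_kernel R \<beta> k K"
  shows "\<zeta> * deriv (ray_value K z p) \<zeta>
    = \<zeta> * of_real (p \<bullet> z) * ray_value K z p \<zeta>
      - (\<Sum>\<alpha>\<in>positive_roots R \<beta>.
          of_real (k \<alpha>) * (ray_value K z p \<zeta> - ray_value K z (refl_root \<alpha> p) \<zeta>))"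
proof -
  let ?defect = "\<lambda>\<zeta>. \<zeta> * deriv (ray_value K z p) \<zeta>
    - (\<zeta> * of_real (p \<bullet> z) * ray_value K z p \<zeta>
      - (\<Sum>\<alpha>\<in>positive_roots R \<beta>.
          of_real (k \<alpha>) * (ray_value K z p \<zeta> - ray_value K z (refl_root \<alpha> p) \<zeta>)))"
  have hol: "ray_value K z q holomorphic_on UNIV" for q
    using K by (auto simp: is_dunkl_kernel_def intro: ray_value_holomorphic)
  have "?defect holomorphic_on UNIV"
    by (intro holomorphic_intros hol) auto
  then have "?defect \<zeta> = 0"
  proof (rule analytic_continuation)
    show "?defect y = 0" if "y \<in> \<real>" for y
      using that by (auto elim!: Reals_cases simp: ray_equation_real[OF K])
  qed (use zero_islimpt_real_axis in auto)
  then show ?thesis by simp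
qed

lemma ray_ode:
  fixes z :: "real ^ 'd"
  assumes K: "is_dunkl_kernel R \<beta> k K" and t: "0 < t"
  defines "F \<equiv> \<lambda>p t. ray_value K z p (- (\<i> * of_real t))"
  shows "(F p has_vector_derivative
    - (\<i> * of_real (p \<bullet> z) * F p t)
    - (\<Sum>\<alpha>\<in>positive_roots R \<beta>. of_real (k \<alpha>) * (F p t - F (refl_root \<alpha> p) t)) / of_real t) (at t)"
proof -
  let ?\<zeta> = "- (\<i> * of_real t)"
  let ?sum = "\<Sum>\<alpha>\<in>positive_roots R \<beta>. of_real (k \<alpha>) * (F p t - F (refl_root \<alpha> p) t)"
  let ?d = "deriv (ray_value K z p) ?\<zeta>"
  have "ray_value K z p holomorphic_on UNIV"
    using K by (auto simp: is_dunkl_kernel_def intro: ray_value_holomorphic)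
  then have "(ray_value K z p has_field_derivative ?d) (at ?\<zeta>)"
    by (rule holomorphic_derivI) auto
  moreover have "((\<lambda>t. - (\<i> * of_real t)) has_vector_derivative - \<i>) (at t)"
    by (auto intro!: derivative_eq_intros)
  ultimately have "(F p has_vector_derivative - \<i> * ?d) (at t)"
    using field_vector_diff_chain_at[of "\<lambda>t. - (\<i> * of_real t)" "- \<i>" t "ray_value K z p" ?d]
    by (simp add: F_def o_def)
  moreover have "of_real t * (- \<i> * ?d) = of_real t * (- (\<i> * of_real (p \<bullet> z) * F p t)) - ?sum"
    using ray_equation[OF K, of ?\<zeta> z p] by (simp add: F_def algebra_simps)
  then have "- \<i> * ?d = - (\<i> * of_real (p \<bullet> z) * F p t) - ?sum / of_real t"
    using t by (simp add: field_simps)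
  ultimately show ?thesis by simp
qed

section \<open>Reflections and roots\<close>

lemma refl_root_normalized:
  assumes "normalized_root_system R" "\<alpha> \<in> R"
  shows "refl_root \<alpha> x = x - (\<alpha> \<bullet> x) *\<^sub>R \<alpha>"
  using assms by (simp add: refl_root_def normalized_root_system_def)

lemma inner_self_root:
  assumes "normalized_root_system R" "\<alpha> \<in> R"
  shows "\<alpha> \<bullet> \<alpha> = 2"
  using assms by (simp add: normalized_root_system_def power2_norm_eq_inner)

lemma refl_root_involution:
  assumes "normalized_root_system R" "\<alpha> \<in> R"
  shows "refl_root \<alpha> (refl_root \<alpha> x) = x"
  by (simp add: refl_root_normalized[OF assms] inner_diff_right inner_self_root[OF assms])

lemma inner_refl_root_commute: "\<alpha> \<bullet> refl_root \<gamma> x = refl_root \<gamma> \<alpha> \<bullet> x"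
  by (simp add: refl_root_def inner_diff_right inner_diff_left inner_commute)

lemma linear_refl_root: "linear (refl_root \<alpha>)"
  by (rule linearI) (simp_all add: refl_root_def algebra_simps inner_right_distrib add_divide_distrib)

lemma refl_root_in_root_system:
  assumes "normalized_root_system R" "\<alpha> \<in> R" "\<gamma> \<in> R"
  shows "refl_root \<alpha> \<gamma> \<in> R"
  using assms by (auto simp: normalized_root_system_def)

lemma reflection_group_linear:
  "w \<in> reflection_group R \<Longrightarrow> linear w"
  by (induction rule: reflection_group.induct)
    (intro linear_compose linear_refl_root linear_id | assumption)+

lemma reflection_group_maps_roots:
  assumes "normalized_root_system R"
  shows "w \<in> reflection_group R \<Longrightarrow> \<alpha> \<in> R \<Longrightarrow> w \<alpha> \<in> R"
  by (induction rule: reflection_group.induct)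
    (auto intro: refl_root_in_root_system[OF assms])

text \<open>
  The group acts faithfully on the finite set of roots, since its elements are linear and the roots
  span the space.
\<close>

lemma finite_reflection_group:
  assumes R: "normalized_root_system R" and span: "span R = UNIV"
  shows "finite (reflection_group R)"
proof (rule inj_on_finite)
  show "inj_on (\<lambda>w. restrict w R) (reflection_group R)"
  proof (rule inj_onI, rule ext)
    fix v w x
    assume vw: "v \<in> reflection_group R" "w \<in> reflection_group R"
      and eq: "restrict v R = restrict w R"
    have "v \<alpha> = w \<alpha>" if "\<alpha> \<in> R" for \<alpha>
      using fun_cong[OF eq, of \<alpha>] that by simp
    then show "v x = w x"
      using vw span by (intro linear_eq_on_span[of v w R x] reflection_group_linear) auto
  qed
  show "(\<lambda>w. restrict w R) ` reflection_group R \<subseteq> R \<rightarrow>\<^sub>E R"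
    using reflection_group_maps_roots[OF R] by auto
  show "finite (R \<rightarrow>\<^sub>E R)"
    using R by (intro finite_PiE) (auto simp: normalized_root_system_def)
qed

lemma reflection_group_regular:
  assumes R: "normalized_root_system R" and x: "x \<in> regular_points R"
  shows "w \<in> reflection_group R \<Longrightarrow> w x \<in> regular_points R"
proof (induction rule: reflection_group.induct)
  case (2 \<alpha> w)
  then show ?case
    using refl_root_in_root_system[OF R]
    by (auto simp: regular_points_def root_hyperplane_def inner_refl_root_commute)
qed (simp add: x)

lemma root_or_minus_positive:
  assumes R: "normalized_root_system R" and \<beta>: "\<beta> \<in> regular_points R" and \<alpha>: "\<alpha> \<in> R"
  shows "\<alpha> \<in> positive_roots R \<beta> \<or> - \<alpha> \<in> positive_roots R \<beta>"
proof -
  have "R \<inter> range (\<lambda>c. c *\<^sub>R \<alpha>) = {\<alpha>, - \<alpha>}"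
    using R \<alpha> by (simp add: normalized_root_system_def)
  then have "- \<alpha> \<in> R" by blast
  moreover have "\<alpha> \<bullet> \<beta> \<noteq> 0"
    using \<beta> \<alpha> by (auto simp: regular_points_def root_hyperplane_def)
  ultimately show ?thesis
    using \<alpha> by (auto simp: positive_roots_def)
qed

text \<open>
  The sum of all \<open>|\<langle>\<alpha>, z\<rangle>|\<close> over the positive roots is positive for \<open>z \<noteq> 0\<close>, because no nonzero
  vector is orthogonal to all roots. By compactness of the sphere and homogeneity it dominates a
  multiple of \<open>\<parallel>z\<parallel>\<close>, and the largest summand is at least the average.
\<close>

lemma exists_large_root_pairing:
  fixes R :: "(real ^ 'd) set"
  assumes R: "normalized_root_system R" and span: "span R = UNIV" and \<beta>: "\<beta> \<in> regular_points R"
  obtains c where "0 < c" "\<And>z. \<exists>\<alpha>\<in>positive_roots R \<beta>. c * norm z \<le> \<bar>\<alpha> \<bullet> z\<bar>"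
proof -
  let ?P = "positive_roots R \<beta>"
  let ?f = "\<lambda>z. \<Sum>\<alpha>\<in>?P. \<bar>\<alpha> \<bullet> z\<bar>"
  have fin: "finite ?P"
    using R by (auto simp: positive_roots_def normalized_root_system_def)
  have pos: "0 < ?f z" if "z \<noteq> 0" for z
  proof (rule ccontr)
    assume "\<not> 0 < ?f z"
    then have "?f z = 0" using sum_nonneg[of ?P "\<lambda>\<alpha>. \<bar>\<alpha> \<bullet> z\<bar>"] by linarith
    then have "\<alpha> \<bullet> z = 0" if "\<alpha> \<in> ?P" for \<alpha>
      using that fin by (simp add: sum_nonneg_eq_0_iff)
    then have "orthogonal z \<alpha>" if "\<alpha> \<in> R" for \<alpha>
      using root_or_minus_positive[OF R \<beta> that] by (force simp: orthogonal_def inner_commute)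
    then have "orthogonal z z"
      using span by (intro orthogonal_to_span[of z R]) auto
    then show False using that by (simp add: orthogonal_def)
  qed
  have "sphere (0 :: real ^ 'd) 1 \<noteq> {}" by simp
  moreover have "continuous_on (sphere (0 :: real ^ 'd) 1) ?f"
    by (intro continuous_intros)
  ultimately have "\<exists>z0\<in>sphere 0 1. \<forall>z\<in>sphere (0 :: real ^ 'd) 1. ?f z0 \<le> ?f z"
    by (intro continuous_attains_inf compact_sphere)
  then obtain z0 where z0: "z0 \<in> sphere 0 1" and min: "\<And>z. z \<in> sphere 0 1 \<Longrightarrow> ?f z0 \<le> ?f z"
    by (elim bexE) (rule that, assumption, drule bspec, assumption+)
  define m where "m = ?f z0"
  have "z0 \<noteq> 0" using z0 by auto
  then have m: "0 < m" unfolding m_def by (rule pos)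
  have ne: "?P \<noteq> {}" using m by (auto simp: m_def)
  have card: "0 < card ?P" using fin ne by (simp add: card_gt_0_iff)
  have lower: "m * norm z \<le> ?f z" for z
  proof (cases "z = 0")
    case False
    have "?f ((1 / norm z) *\<^sub>R z) = ?f z / norm z"
      by (simp add: sum_divide_distrib abs_mult)
    moreover have "m \<le> ?f ((1 / norm z) *\<^sub>R z)"
      unfolding m_def using False by (intro min) simp
    ultimately have "m \<le> ?f z / norm z" by simp
    then show ?thesis using False by (simp add: pos_le_divide_eq)
  qed simp
  have "\<exists>\<alpha>\<in>?P. m / card ?P * norm z \<le> \<bar>\<alpha> \<bullet> z\<bar>" for z
  proof (rule ccontr)
    assume "\<not> ?thesis"
    then have "?f z < (\<Sum>\<alpha>\<in>?P. m / card ?P * norm z)"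
      using fin ne by (intro sum_strict_mono) auto
    then show False using lower[of z] card by simp
  qed
  then show thesis using m card by (intro that[of "m / card ?P"]) auto
qed

section \<open>Decay of the Dunkl kernel\<close>

lemma finite_positive_lower_bound:
  fixes f :: "'a \<Rightarrow> real"
  assumes "finite A" "\<And>a. a \<in> A \<Longrightarrow> 0 < f a"
  obtains \<delta> where "0 < \<delta>" "\<And>a. a \<in> A \<Longrightarrow> \<delta> \<le> f a"
  \<comment> \<open>the element 1 covers the case that \<open>A\<close> is empty\<close>
  using assms by (intro that[of "Min (insert 1 (f ` A))"]) (auto simp: Min_gr_iff)

text \<open>
  The constants depend on \<open>x\<close> but not on \<open>z\<close>: \<open>\<kappa>\<close> is a positive lower bound for
  the multiplicities, and \<open>C\<close> is the
  product of the constant in the lower bound for the largest \<open>|\<langle>\<alpha>, z\<rangle>|\<close> with a positive lower bound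
  \<open>\<delta>\<close> for \<open>|\<langle>\<alpha>, p\<rangle>|\<close>, where \<open>p\<close> runs through the orbit of \<open>x\<close>. So \<open>C \<parallel>z\<parallel>\<close> is a lower bound for the
  frequency gaps that belong to a suitable root.
\<close>

lemma dunkl_kernel_log_bound:
  fixes R :: "(real ^ 'd) set"
  assumes R: "normalized_root_system R" and span: "span R = UNIV"
    and \<beta>: "\<beta> \<in> regular_points R"
    and k_pos: "\<forall>\<alpha>\<in>R. k \<alpha> > 0"
    and K: "is_dunkl_kernel R \<beta> k K"
    and x: "x \<in> regular_points R"
  shows "\<exists>C>0. \<exists>\<kappa>>0. \<exists>M. \<forall>z. 1 \<le> C * norm z \<longrightarrow>
    (norm (K ((- \<i>) *s cvec x) (cvec z)))\<^sup>2 \<le> M / (1 + 2 * \<kappa> * ln (C * norm z))"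
proof -
  define P where "P = positive_roots R \<beta>"
  define S where "S = (\<lambda>w. w x) ` reflection_group R"
  have PR: "P \<subseteq> R" by (auto simp: P_def positive_roots_def)
  have fin_P: "finite P"
    using R PR by (auto simp: normalized_root_system_def intro: finite_subset)
  have fin_S: "finite S"
    unfolding S_def by (intro finite_imageI finite_reflection_group R span)
  have S_reg: "S \<subseteq> regular_points R"
    unfolding S_def using reflection_group_regular[OF R x] by auto
  have x_S: "x \<in> S"
    unfolding S_def using reflection_group.intros(1)[of R] by (force simp: id_def)
  have S_refl: "refl_root \<alpha> p \<in> S" if "\<alpha> \<in> P" "p \<in> S" for \<alpha> p
    using that PR reflection_group.intros(2)[of \<alpha> R] by (force simp: S_def o_def)
  obtain c where c: "0 < c" "\<And>z. \<exists>\<alpha>\<in>P. c * norm z \<le> \<bar>\<alpha> \<bullet> z\<bar>"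
    using exists_large_root_pairing[OF R span \<beta>] unfolding P_def by blast
  obtain \<delta> where \<delta>: "0 < \<delta>" "\<And>\<alpha> p. \<alpha> \<in> P \<Longrightarrow> p \<in> S \<Longrightarrow> \<delta> \<le> \<bar>\<alpha> \<bullet> p\<bar>"
  proof (rule finite_positive_lower_bound[of "P \<times> S" "\<lambda>(\<alpha>, p). \<bar>\<alpha> \<bullet> p\<bar>"])
    show "0 < (case q of (\<alpha>, p) \<Rightarrow> \<bar>\<alpha> \<bullet> p\<bar>)" if "q \<in> P \<times> S" for q
      using that S_reg PR by (force simp: regular_points_def root_hyperplane_def)
  qed (use fin_P fin_S in auto)
  obtain \<kappa> where \<kappa>: "0 < \<kappa>" "\<And>\<alpha>. \<alpha> \<in> P \<Longrightarrow> \<kappa> \<le> k \<alpha>"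
    using finite_positive_lower_bound[OF fin_P, of k] k_pos PR by blast
  have k_nonneg: "0 \<le> k \<alpha>" if "\<alpha> \<in> P" for \<alpha> using \<kappa> that by force
  define M where "M = card S + 4 * sum k P * ((4 * sum k P + 1) * (card S)\<^sup>2)"
  have bound: "(norm (K ((- \<i>) *s cvec x) (cvec z)))\<^sup>2 \<le> M / (1 + 2 * \<kappa> * ln (\<delta> * c * norm z))"
    if large: "1 \<le> \<delta> * c * norm z" for z
  proof -
    define F where "F = (\<lambda>p t. ray_value K z p (- (\<i> * of_real t)))"
    interpret reflection_ode S P refl_root k "\<lambda>p. p \<bullet> z" F
    proof
      show "(F p has_vector_derivative
          - (\<i> * of_real (p \<bullet> z) * F p t)
          - (\<Sum>\<alpha>\<in>P. of_real (k \<alpha>) * (F p t - F (refl_root \<alpha> p) t)) / of_real t) (at t)"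
        if "p \<in> S" "0 < t" for p t
        unfolding F_def P_def by (rule ray_ode[OF K that(2)])
      show "refl_root \<alpha> (refl_root \<alpha> p) = p" if "\<alpha> \<in> P" "p \<in> S" for \<alpha> p
        using that PR by (intro refl_root_involution[OF R]) auto
      show "isCont (F p) 0" for p
      proof -
        have "ray_value K z p holomorphic_on UNIV"
          using K by (auto simp: is_dunkl_kernel_def intro: ray_value_holomorphic)
        then have "continuous_on UNIV (ray_value K z p)"
          by (rule holomorphic_on_imp_continuous_on)
        then have "continuous_on UNIV (F p)"
          unfolding F_def by (rule continuous_on_compose2) (auto intro!: continuous_intros)
        then show ?thesis by (simp add: continuous_on_eq_continuous_at)
      qed
      show "F p 0 = 1" for p
        using K by (simp add: F_def ray_value_def is_dunkl_kernel_def dunkl_eigenfunction_def cvec_0)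
    qed (use fin_S fin_P S_refl k_nonneg in auto)
    obtain \<alpha> where \<alpha>: "\<alpha> \<in> P" "c * norm z \<le> \<bar>\<alpha> \<bullet> z\<bar>"
      using c(2) by blast
    have gap: "\<delta> * c * norm z \<le> \<bar>p \<bullet> z - refl_root \<alpha> p \<bullet> z\<bar>" if "p \<in> S" for p
    proof -
      have "\<delta> * (c * norm z) \<le> \<bar>\<alpha> \<bullet> p\<bar> * \<bar>\<alpha> \<bullet> z\<bar>"
        using \<delta>(2)[OF \<alpha>(1) that] \<alpha>(2) c(1) \<delta>(1) by (intro mult_mono) auto
      moreover have "p \<bullet> z - refl_root \<alpha> p \<bullet> z = (\<alpha> \<bullet> p) * (\<alpha> \<bullet> z)"
        using \<alpha>(1) PR by (subst refl_root_normalized[OF R]) (auto simp: inner_diff_left)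
      ultimately show ?thesis by (simp add: abs_mult mult.assoc)
    qed
    have ln: "0 \<le> ln (\<delta> * c * norm z)" using large by simp
    have energy_nonneg: "0 \<le> energy 1"
      unfolding energy_def by (simp add: sum_nonneg)
    have "energy 1 * (1 + 2 * \<kappa> * ln (\<delta> * c * norm z))
        \<le> energy 1 * (1 + 2 * k \<alpha> * ln (\<delta> * c * norm z))"
      using \<kappa>(2)[OF \<alpha>(1)] ln energy_nonneg
      by (intro mult_left_mono add_left_mono mult_right_mono) auto
    also have "\<dots> \<le> card S + 4 * k \<alpha> * ((4 * sum k P + 1) * (card S)\<^sup>2)"
      using energy_decay[OF \<alpha>(1) large gap] by simp
    also have "\<dots> \<le> M"
      unfolding M_def using fin_P \<alpha>(1) k_nonneg
      by (intro add_left_mono mult_right_mono mult_left_mono member_le_sum)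
        (auto intro!: mult_nonneg_nonneg add_nonneg_nonneg sum_nonneg)
    finally have "energy 1 \<le> M / (1 + 2 * \<kappa> * ln (\<delta> * c * norm z))"
      using ln \<kappa>(1) by (subst pos_le_divide_eq) (auto intro!: add_pos_nonneg)
    moreover have "(norm (F x 1))\<^sup>2 \<le> energy 1"
      unfolding energy_def using fin_S x_S by (intro member_le_sum) auto
    moreover have "F x 1 = K ((- \<i>) *s cvec x) (cvec z)"
      by (simp add: F_def ray_value_def)
    ultimately show ?thesis by simp
  qed
  have "0 < \<delta> * c" using \<delta>(1) c(1) by simp
  then show ?thesis using bound \<kappa>(1) by blast
qed

lemma dunkl_kernel_tendsto_0:
  fixes R :: "(real ^ 'd) set"
  assumes "normalized_root_system R" "span R = UNIV" "\<beta> \<in> regular_points R"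
    "\<forall>\<alpha>\<in>R. k \<alpha> > 0" "is_dunkl_kernel R \<beta> k K" "x \<in> regular_points R"
  shows "((\<lambda>z. K ((- \<i>) *s cvec x) (cvec z)) \<longlongrightarrow> 0) at_infinity"
proof -
  obtain M C \<kappa> where C: "0 < C" and \<kappa>: "0 < \<kappa>"
    and bound: "\<And>z. 1 \<le> C * norm z \<Longrightarrow>
      (norm (K ((- \<i>) *s cvec x) (cvec z)))\<^sup>2 \<le> M / (1 + 2 * \<kappa> * ln (C * norm z))"
    using dunkl_kernel_log_bound[OF assms] by metis
  have lim: "filterlim (\<lambda>z :: real ^ 'd. C * norm z) at_top at_infinity"
    by (rule filterlim_tendsto_pos_mult_at_top[OF tendsto_const C filterlim_norm_at_top])
  have "filterlim (\<lambda>z :: real ^ 'd. 1 + 2 * \<kappa> * ln (C * norm z)) at_top at_infinity"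
    using \<kappa> by (intro filterlim_tendsto_add_at_top[OF tendsto_const]
        filterlim_tendsto_pos_mult_at_top[OF tendsto_const]
        filterlim_compose[OF ln_at_top lim]) auto
  then have "((\<lambda>z :: real ^ 'd. M / (1 + 2 * \<kappa> * ln (C * norm z))) \<longlongrightarrow> 0) at_infinity"
    by (intro tendsto_divide_0[OF tendsto_const] filterlim_at_top_imp_at_infinity)
  from tendsto_real_sqrt[OF this]
  have "((\<lambda>z :: real ^ 'd. sqrt (M / (1 + 2 * \<kappa> * ln (C * norm z)))) \<longlongrightarrow> 0) at_infinity"
    by simp
  moreover have "eventually (\<lambda>z :: real ^ 'd. norm (K ((- \<i>) *s cvec x) (cvec z))
      \<le> sqrt (M / (1 + 2 * \<kappa> * ln (C * norm z)))) at_infinity"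
    using filterlim_at_top[THEN iffD1, OF lim, rule_format, of 1]
    by eventually_elim (rule real_le_rsqrt[OF bound])
  ultimately show ?thesis
    by (rule Lim_null_comparison[rotated])
qed

lemma dunkl_weight_eq_0:
  assumes "normalized_root_system R" "\<beta> \<in> regular_points R"
    "\<forall>\<alpha>\<in>R. k \<alpha> > 0" "x \<notin> regular_points R"
  shows "dunkl_weight R \<beta> k x = 0"
proof -
  obtain \<alpha> where \<alpha>: "\<alpha> \<in> R" "\<alpha> \<bullet> x = 0"
    using assms(4) by (auto simp: regular_points_def root_hyperplane_def)
  obtain \<gamma> where \<gamma>: "\<gamma> \<in> positive_roots R \<beta>" "\<gamma> \<bullet> x = 0"
    using root_or_minus_positive[OF assms(1,2) \<alpha>(1)] \<alpha>(2) by (metis inner_minus_left minus_zero)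
  moreover have "finite (positive_roots R \<beta>)"
    using assms(1) by (auto simp: positive_roots_def normalized_root_system_def)
  moreover have "k \<gamma> \<noteq> 0"
    using \<gamma>(1) assms(3) by (force simp: positive_roots_def)
  ultimately show ?thesis
    unfolding dunkl_weight_def by (intro prod_zero) auto
qed

theorem theorem4p1:
  fixes R :: "(real ^ 'd) set"
    and \<beta> :: "real ^ 'd"
    and k :: "real ^ 'd \<Rightarrow> real"
    and K :: "complex ^ 'd \<Rightarrow> complex ^ 'd \<Rightarrow> complex"
  assumes "normalized_root_system R"
    and "span R = UNIV"
    and "\<beta> \<in> regular_points R"
    and "multiplicity_function R k"
    and "\<forall>\<alpha>\<in>R. k \<alpha> > 0"
    and "is_dunkl_kernel R \<beta> k K"
  shows "(\<forall>x :: real ^ 'd.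
           ((\<lambda>z. complex_of_real (dunkl_weight R \<beta> k x) * K ((- \<i>) *s cvec x) (cvec z))
              \<longlongrightarrow> 0) at_infinity) \<and>
         (\<forall>x \<in> regular_points R.
           ((\<lambda>z. K ((- \<i>) *s cvec x) (cvec z)) \<longlongrightarrow> 0) at_infinity)"
proof -
  have regular: "((\<lambda>z. K ((- \<i>) *s cvec x) (cvec z)) \<longlongrightarrow> 0) at_infinity"
    if "x \<in> regular_points R" for x
    using assms that by (intro dunkl_kernel_tendsto_0[where R = R and \<beta> = \<beta> and k = k])
  moreover have "((\<lambda>z. complex_of_real (dunkl_weight R \<beta> k x) * K ((- \<i>) *s cvec x) (cvec z))
      \<longlongrightarrow> 0) at_infinity" for x
  proof (cases "x \<in> regular_points R")
    case True
    then show ?thesis by (intro tendsto_mult_right_zero regular)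
  next
    case False
    then show ?thesis using dunkl_weight_eq_0[OF assms(1,3,5)] by simp
  qed
  ultimately show ?thesis by blast
qed

end
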